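(* Let $n\ge 1$, $k\ge 0$ and $k+1\le l\le n+k-1$ be integers. Then $$p^l_{n,n+k;\le n+k}-p^{l+1}_{n,n+k;\le n+k}=\binom{n-1}{l-k-1}\,p_{l-k-1,\,l-1;\le l-1}\,p_{n+k-l}.$$
   Context: Parking model: there are $m$ parking spaces in a line, numbered $1,\dots,m$. A preference set of length $n$ is a sequence $(a_1,\dots,a_n)$ of integers with $1\le a_i\le m$; cars $1,\dots,n$ arrive in order, car $i$ parks in the first unoccupied space numbered $\ge a_i$ if one exists, otherwise it fails to park. A parking function is a preference set in which all cars park. $p_{n,m;\le s}$ denotes the number of parking functions of length $n$ with $m$ spaces and all $a_i\le s$, and $p^l_{n,m;\le s}$ the number of those with $a_1=l$. $p_j$ denotes the number of parking functions of length $j$ with $j$ spaces, $p_j=(j+1)^{j-1}$. The empty sequence (length $0$) counts as a parking function, so $p_{0,m;\le s}=1$ and $p_0=1$. *)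

theory Defs
  imports Complex_Main
begin

definition free_spaces :: "nat \<Rightarrow> nat set \<Rightarrow> nat \<Rightarrow> nat set" where
  "free_spaces m occ a = {j \<in> {1..m}. a \<le> j \<and> j \<notin> occ}"

text \<open>The process is run on the remaining cars, where \<open>occ\<close> is the set of spaces already
  occupied; the result is whether every remaining car parks.\<close>

primrec all_park :: "nat \<Rightarrow> nat set \<Rightarrow> nat list \<Rightarrow> bool" where
  "all_park m occ [] = True"
| "all_park m occ (a # as) =
     (free_spaces m occ a \<noteq> {} \<and> all_park m (insert (Min (free_spaces m occ a)) occ) as)"

definition preference_sets :: "nat \<Rightarrow> nat \<Rightarrow> nat list set" where
  "preference_sets n m = {as. length as = n \<and> set as \<subseteq> {1..m}}"

definition parking_functions :: "nat \<Rightarrow> nat \<Rightarrow> nat list set" where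
  "parking_functions n m = {as \<in> preference_sets n m. all_park m {} as}"

definition pf_count_le :: "nat \<Rightarrow> nat \<Rightarrow> nat \<Rightarrow> nat" where
  "pf_count_le n m s = card {as \<in> parking_functions n m. \<forall>a \<in> set as. a \<le> s}"

text \<open>In \<open>pf_count_first l n m s\<close> the first car must exist, so the count is \<open>0\<close> for
  \<open>n = 0\<close>.\<close>

definition pf_count_first :: "nat \<Rightarrow> nat \<Rightarrow> nat \<Rightarrow> nat \<Rightarrow> nat" where
  "pf_count_first l n m s =
     card {as \<in> parking_functions n m. (\<forall>a \<in> set as. a \<le> s) \<and> as \<noteq> [] \<and> hd as = l}"

definition pf_count :: "nat \<Rightarrow> nat" where
  "pf_count j = card (parking_functions j j)"

end

theory Submission
  imports Defs
begin

text \<open>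
  By Hall's condition for the nested intervals \<open>{a..m}\<close>, all cars park iff for every \<open>j \<ge> 1\<close> at
  most \<open>m + 1 - j\<close> cars prefer a space \<open>\<ge> j\<close>. Hence a tail \<open>b\<close> which completes \<open>l + 1\<close> to a parking
  function also completes \<open>l\<close>, and a tail that completes \<open>l\<close> fails for \<open>l + 1\<close> exactly when the
  condition at \<open>j = l + 1\<close> is tight, i.e. when \<open>m - l\<close> entries of \<open>b\<close> exceed \<open>l\<close>. Tightness
  decouples the entries: no entry equals \<open>l\<close>, those below \<open>l\<close> park in \<open>{1..l - 1}\<close>, and those above
  \<open>l\<close>, shifted by \<open>l\<close>, form a parking function of length \<open>m - l\<close>. So these tails are
  the shuffles of two such sequences.
\<close>

section \<open>Hall's criterion for parking\<close>

lemma finite_free_spaces [simp]: "finite (free_spaces m occ a)"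
  by (simp add: free_spaces_def)

lemma free_spaces_insert: "free_spaces m (insert p occ) j = free_spaces m occ j - {p}"
  by (auto simp: free_spaces_def)

lemma free_spaces_antimono: "i \<le> j \<Longrightarrow> free_spaces m occ j \<subseteq> free_spaces m occ i"
  by (auto simp: free_spaces_def)

lemma card_free_spaces_empty: "1 \<le> j \<Longrightarrow> card (free_spaces m {} j) = Suc m - j"
proof -
  assume "1 \<le> j"
  then have "free_spaces m {} j = {j..m}"
    by (auto simp: free_spaces_def)
  then show ?thesis by simp
qed

abbreviation count_ge :: "nat \<Rightarrow> nat list \<Rightarrow> nat" where
  "count_ge j as \<equiv> length (filter (\<lambda>a. j \<le> a) as)"

lemma count_ge_antimono: "i \<le> j \<Longrightarrow> count_ge j as \<le> count_ge i as"
  by (induction as) auto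

text \<open>Induction on the cars, with \<open>occ\<close> arbitrary since each car enlarges it. If
  the first car parks at \<open>p\<close>, the left side drops by one for \<open>j <= a\<close> and
  the right side for \<open>j <= p\<close>; only \<open>a < j <= p\<close> needs an
  argument.\<close>

lemma all_park_iff: "all_park m occ as \<longleftrightarrow> (\<forall>j. count_ge j as \<le> card (free_spaces m occ j))"
proof (induction as arbitrary: occ)
  case Nil
  show ?case by simp
next
  case (Cons a as)
  let ?F = "free_spaces m occ"
  show ?case
  proof (cases "?F a = {}")
    case True
    then have "\<not> count_ge a (a # as) \<le> card (?F a)" by simp
    then have "\<not> (\<forall>j. count_ge j (a # as) \<le> card (?F j))" by blast
    with True show ?thesis by simp
  next
    case False
    define p where "p = Min (?F a)"
    have p: "p \<in> ?F a" "\<And>x. x \<in> ?F a \<Longrightarrow> p \<le> x"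
      using False by (auto simp: p_def)
    then have "a \<le> p" by (simp add: free_spaces_def)
    have card_rm: "card (?F j - {p}) = (if j \<le> p then card (?F j) - 1 else card (?F j))" for j
      using p(1) by (auto simp: free_spaces_def)
    have card_pos: "card (?F j) \<ge> 1" if "j \<le> p" for j
    proof -
      have "p \<in> ?F j" using p(1) that by (simp add: free_spaces_def)
      then show ?thesis by (metis One_nat_def Suc_leI card_gt_0_iff empty_iff finite_free_spaces)
    qed
    \<comment> \<open>By minimality of \<open>p\<close> no space from \<open>a\<close> up to
      \<open>p - 1\<close> is free, so the bound at \<open>a\<close>, where the first car is
      counted, supplies the missing unit at \<open>j\<close>.\<close>
    have gap: "?F j = ?F a" if "a \<le> j" "j \<le> p" for j
      using that p(2) by (force simp: free_spaces_def)
    have "all_park m occ (a # as) \<longleftrightarrow> (\<forall>j. count_ge j as \<le> card (?F j - {p}))"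
      using False by (simp add: Cons.IH free_spaces_insert p_def)
    also have "\<dots> \<longleftrightarrow> (\<forall>j. count_ge j (a # as) \<le> card (?F j))"
    proof (intro iffI allI)
      fix j
      assume *: "\<forall>j. count_ge j as \<le> card (?F j - {p})"
      show "count_ge j (a # as) \<le> card (?F j)"
        using *[rule_format, of j] card_rm[of j] card_pos[of j] \<open>a \<le> p\<close>
        by (auto split: if_splits)
    next
      fix j
      assume *: "\<forall>j. count_ge j (a # as) \<le> card (?F j)"
      consider "j \<le> a" | "a \<le> j" "j \<le> p" | "p < j" by linarith
      then show "count_ge j as \<le> card (?F j - {p})"
      proof cases
        case 1
        then show ?thesis using *[rule_format, of j] card_rm[of j] \<open>a \<le> p\<close> by simp
      next
        case 2
        then show ?thesis
          using *[rule_format, of a] card_rm[of j] gap[of j] count_ge_antimono[of a j as] by simp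
      next
        case 3
        then show ?thesis using *[rule_format, of j] card_rm[of j] \<open>a \<le> p\<close> by simp
      qed
    qed
    finally show ?thesis .
  qed
qed

lemma parking_functions_iff:
  "as \<in> parking_functions n m \<longleftrightarrow>
     length as = n \<and> (\<forall>a\<in>set as. 1 \<le> a) \<and> (\<forall>j\<ge>1. count_ge j as \<le> Suc m - j)"
  (is "?L \<longleftrightarrow> ?R")
proof
  assume ?L
  then show ?R
    by (auto simp: parking_functions_def preference_sets_def all_park_iff)
       (metis card_free_spaces_empty One_nat_def)
next
  assume R: ?R
  \<comment> \<open>The upper bound on the entries is the case \<open>j = Suc m\<close>, where the
    right side is 0.\<close>
  have "count_ge (Suc m) as \<le> Suc m - Suc m"
    using R by (metis le_add1 plus_1_eq_Suc)
  then have le: "\<forall>a\<in>set as. a \<le> m" by (auto simp: filter_empty_conv not_le)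
  have "count_ge j as \<le> card (free_spaces m {} j)" for j
  \<comment> \<open>There is no space 0, so \<open>j = 0\<close> is reduced to \<open>j = 1\<close>;
    the counts agree because all entries are positive.\<close>
  proof (cases "j = 0")
    case True
    have "count_ge 0 as = count_ge 1 as"
      using R by (intro arg_cong[where f = length] filter_cong) auto
    also have "\<dots> \<le> card (free_spaces m {} 1)"
      using R by (metis card_free_spaces_empty order_refl)
    also have "\<dots> \<le> card (free_spaces m {} 0)"
      by (intro card_mono free_spaces_antimono) auto
    finally show ?thesis using True by simp
  next
    case False
    then show ?thesis using R by (simp add: card_free_spaces_empty)
  qed
  with R le show ?L
    by (auto simp: parking_functions_def preference_sets_def all_park_iff)
qed

section \<open>Reduction of the counts to sets of tails\<close>

lemma parking_functions_le: "as \<in> parking_functions n m \<Longrightarrow> a \<in> set as \<Longrightarrow> 1 \<le> a \<and> a \<le> m"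
  by (auto simp: parking_functions_def preference_sets_def)

lemma finite_parking_functions: "finite (parking_functions n m)"
proof (rule finite_subset)
  show "parking_functions n m \<subseteq> {as. set as \<subseteq> {1..m} \<and> length as = n}"
    by (auto simp: parking_functions_def preference_sets_def)
qed (simp add: finite_lists_length_eq)

lemma pf_count_le_self: "pf_count_le n m m = card (parking_functions n m)"
  unfolding pf_count_le_def by (rule arg_cong[where f = card]) (auto dest: parking_functions_le)

lemma pf_count_first_self: "pf_count_first l n m m = card {b. l # b \<in> parking_functions n m}"
proof -
  have "{as \<in> parking_functions n m. (\<forall>a\<in>set as. a \<le> m) \<and> as \<noteq> [] \<and> hd as = l}
      = (#) l ` {b. l # b \<in> parking_functions n m}" (is "?A = _ ` ?B")
    by (auto simp: image_iff neq_Nil_conv dest: parking_functions_le)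
  moreover have "inj_on ((#) l) ?B" by simp
  ultimately show ?thesis by (simp add: pf_count_first_def card_image)
qed

text \<open>Lowering the first entry raises no count in Hall's condition. This gives the inclusion
  that turns the difference of counts into the cardinality of a set difference.\<close>

lemma parking_functions_head_mono:
  assumes "1 \<le> l" "Suc l # b \<in> parking_functions n m"
  shows "l # b \<in> parking_functions n m"
proof -
  have "count_ge j (l # b) \<le> count_ge j (Suc l # b)" for j by simp
  then show ?thesis
    using assms unfolding parking_functions_iff by (auto simp del: filter.simps intro: le_trans)
qed

section \<open>Critical tails as shuffles\<close>

lemma count_filter_shuffles:
  assumes "zs \<in> shuffles xs ys"
  shows "length (filter P zs) = length (filter P xs) + length (filter P ys)"
proof -
  have "filter P zs \<in> shuffles (filter P xs) (filter P ys)"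
    using assms by (metis filter_shuffles imageI)
  then show ?thesis by (rule length_shuffles)
qed

lemma shuffles_critical:
  assumes "1 \<le> l" "u \<in> parking_functions q (l - 1)" "v \<in> parking_functions r r"
    and b: "b \<in> shuffles u (map ((+) l) v)"
  shows "l # b \<in> parking_functions (Suc (q + r)) (l + r)"
    and "Suc l # b \<notin> parking_functions (Suc (q + r)) (l + r)"
proof -
  have cnt: "count_ge j b = count_ge j u + count_ge j (map ((+) l) v)" for j
    using count_filter_shuffles[OF b] .
  have len: "length u = q" "length v = r"
    using assms by (auto simp: parking_functions_iff)
  \<comment> \<open>For \<open>j > l\<close> the truncated difference is 0, so \<open>u\<close>
    contributes nothing there.\<close>
  have u: "count_ge j u \<le> l - j" if "j \<ge> 1" for j
    using assms that by (auto simp: parking_functions_iff)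
  have high: "count_ge j (map ((+) l) v) \<le> Suc (l + r) - j" if "j > l" for j
  proof -
    have "count_ge j (map ((+) l) v) = count_ge (j - l) v"
      using that by (simp add: filter_map o_def le_diff_conv add.commute)
    also have "\<dots> \<le> Suc r - (j - l)"
      using assms(3) that unfolding parking_functions_iff
      by (metis less_eq_Suc_le One_nat_def zero_less_diff)
    finally show ?thesis using that by simp
  qed
  have low: "count_ge j (map ((+) l) v) \<le> r" for j
    using length_filter_le[of "\<lambda>a. j \<le> a" "map ((+) l) v"] len by simp
  have tight: "count_ge (Suc l) (map ((+) l) v) = r"
  proof -
    have "filter (\<lambda>a. Suc l \<le> a) (map ((+) l) v) = map ((+) l) v"
      using assms(3) by (auto simp: parking_functions_iff filter_id_conv)
    then show ?thesis using len by simp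
  qed
  \<comment> \<open>For \<open>j <= l\<close> the contributions of the head, \<open>u\<close> and
    the shifted \<open>v\<close> are at most \<open>1 + (l - j) + r\<close>, exactly the bound; for
    \<open>j > l\<close> only the shifted \<open>v\<close> counts.\<close>
  have "count_ge j (l # b) \<le> Suc (l + r) - j" if "j \<ge> 1" for j
    using u[OF that] high[of j] low[of j] cnt[of j] by (cases "j > l") auto
  moreover have "length b = q + r"
    using length_shuffles[OF b] len by simp
  moreover have "\<forall>a\<in>set b. 1 \<le> a"
    using set_shuffles[OF b] assms by (auto simp: parking_functions_iff)
  ultimately show "l # b \<in> parking_functions (Suc (q + r)) (l + r)"
    using \<open>1 \<le> l\<close> by (simp add: parking_functions_iff del: filter.simps)
  have "count_ge (Suc l) (Suc l # b) > Suc (l + r) - Suc l"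
    using cnt[of "Suc l"] tight by simp
  then show "Suc l # b \<notin> parking_functions (Suc (q + r)) (l + r)"
    by (metis One_nat_def Suc_le_mono le0 not_le parking_functions_iff)
qed

text \<open>Converse of \<open>shuffles_critical\<close>: splitting \<open>b\<close> into entries at
  most \<open>l\<close> and entries above \<open>l\<close> recovers the two factors.\<close>

lemma critical_shuffles:
  assumes "1 \<le> l"
    and in1: "l # b \<in> parking_functions (Suc (q + r)) (l + r)"
    and notin: "Suc l # b \<notin> parking_functions (Suc (q + r)) (l + r)"
  obtains u v where "u \<in> parking_functions q (l - 1)" "v \<in> parking_functions r r"
    "b \<in> shuffles u (map ((+) l) v)"
proof -
  define u where "u = filter (\<lambda>a. \<not> Suc l \<le> a) b"
  define w where "w = filter (\<lambda>a. Suc l \<le> a) b"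
  define v where "v = map (\<lambda>a. a - l) w"
  have w: "w = map ((+) l) v"
    unfolding v_def w_def by (auto simp: o_def intro!: map_idI[symmetric])
  have bsh: "b \<in> shuffles u w"
    unfolding u_def w_def using partition_in_shuffles[of b "\<lambda>a. \<not> Suc l \<le> a"] by simp
  have lenb: "length b = q + r" and pos: "\<forall>a\<in>set b. 1 \<le> a"
    using in1 by (auto simp: parking_functions_iff)
  have hall: "count_ge j (l # b) \<le> Suc (l + r) - j" if "j \<ge> 1" for j
    using in1 that by (simp add: parking_functions_iff del: filter.simps)
  obtain j where j: "j \<ge> 1" "\<not> count_ge j (Suc l # b) \<le> Suc (l + r) - j"
    using notin lenb pos by (auto simp: parking_functions_iff simp del: filter.simps)
  \<comment> \<open>The heads \<open>l\<close> and \<open>Suc l\<close> give different counts only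
    at this threshold.\<close>
  then have "j = Suc l"
    using hall[of j] by (auto split: if_splits)
  then have tight: "length w = r"
    using j hall[of "Suc l"] by (simp add: w_def)
  then have lenu: "length u = q"
    using length_shuffles[OF bsh] lenb by simp
  have "count_ge j u \<le> Suc (l - 1) - j" if "j \<ge> 1" for j
  proof (cases "j \<le> l")
    case True
    \<comment> \<open>The head and all \<open>r\<close> entries of \<open>w\<close> count here,
      leaving \<open>l - j\<close> for \<open>u\<close>. At \<open>j = l\<close> this is 0, which
      excludes the entry \<open>l\<close> from \<open>u\<close>.\<close>
    then have "filter (\<lambda>a. j \<le> a) w = w"
      unfolding filter_id_conv by (auto simp: w_def)
    then have "count_ge j b = count_ge j u + r"
      using count_filter_shuffles[OF bsh, of "\<lambda>a. j \<le> a"] tight by simp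
    then show ?thesis using hall[OF that] True \<open>1 \<le> l\<close> by simp
  next
    case False
    then have "filter (\<lambda>a. j \<le> a) u = []"
      by (auto simp: u_def filter_empty_conv)
    then show ?thesis by simp
  qed
  then have "u \<in> parking_functions q (l - 1)"
    using lenu pos by (auto simp: parking_functions_iff u_def)
  moreover have "v \<in> parking_functions r r"
  proof -
    have "count_ge j v \<le> Suc r - j" if "j \<ge> 1" for j
    proof -
      have "count_ge j v = count_ge (j + l) w"
        unfolding w by (simp add: filter_map o_def add.commute)
      also have "\<dots> \<le> count_ge (j + l) b"
        using count_filter_shuffles[OF bsh] by simp
      also have "\<dots> \<le> Suc r - j"
        using hall[of "j + l"] that by simp
      finally show ?thesis .
    qed
    then show ?thesis
      using tight by (auto simp: parking_functions_iff v_def w_def)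
  qed
  ultimately show thesis using that bsh w by blast
qed

text \<open>The critical tails are a disjoint union of shuffle sets over pairs
  \<open>(u, v)\<close>. Since \<open>u\<close> and the shifted \<open>v\<close> share no entry,
  each shuffle set has binomial size.\<close>

lemma card_critical_tails:
  assumes "1 \<le> l"
  shows "card ({b. l # b \<in> parking_functions (Suc (q + r)) (l + r)}
             - {b. Suc l # b \<in> parking_functions (Suc (q + r)) (l + r)})
       = (q + r choose q) * card (parking_functions q (l - 1)) * card (parking_functions r r)"
    (is "card ?D = _")
proof -
  let ?P = "parking_functions q (l - 1) \<times> parking_functions r r"
  let ?S = "\<lambda>(u, v). shuffles u (map ((+) l) v)"
  \<comment> \<open>A tail determines its pair, which makes the union disjoint.\<close>
  have sep: "filter (\<lambda>a. a < l) b = u \<and> filter (\<lambda>a. \<not> a < l) b = map ((+) l) v"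
    if uv: "(u, v) \<in> ?P" and b: "b \<in> ?S (u, v)" for u v b
  proof -
    have u: "\<forall>a\<in>set u. a < l"
    proof
      fix a assume "a \<in> set u"
      with uv show "a < l" using parking_functions_le[of u q "l - 1" a] assms by auto
    qed
    have "filter (\<lambda>a. a < l) u = u" "filter (\<lambda>a. \<not> a < l) u = []"
         "filter (\<lambda>a. a < l) (map ((+) l) v) = []"
         "filter (\<lambda>a. \<not> a < l) (map ((+) l) v) = map ((+) l) v"
      using u by (auto simp: filter_id_conv filter_empty_conv)
    moreover have "filter Q b \<in> shuffles (filter Q u) (filter Q (map ((+) l) v))" for Q
      using b by (metis case_prod_conv filter_shuffles imageI)
    ultimately show ?thesis by (metis shuffles.simps(1,2) singletonD)
  qed
  have card_S: "card (?S p) = (q + r choose q)" if "p \<in> ?P" for p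
  proof -
    obtain u v where p: "p = (u, v)" by (cases p)
    have "set u \<inter> set (map ((+) l) v) = {}"
      using that parking_functions_le[of u q "l - 1"] assms p by fastforce
    moreover have "length u = q" "length v = r"
      using that p by (auto simp: parking_functions_iff)
    ultimately show ?thesis using p by (simp add: card_disjoint_shuffles)
  qed
  have "?D = (\<Union>p\<in>?P. ?S p)"
  proof (intro set_eqI iffI)
    fix b assume "b \<in> ?D"
    then show "b \<in> (\<Union>p\<in>?P. ?S p)"
      by (auto elim!: critical_shuffles[OF assms])
  next
    fix b assume "b \<in> (\<Union>p\<in>?P. ?S p)"
    then show "b \<in> ?D"
      using shuffles_critical[OF assms] by auto
  qed
  moreover have "card (\<Union>p\<in>?P. ?S p) = (\<Sum>p\<in>?P. card (?S p))"
  proof (rule card_UN_disjoint)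
    show "\<forall>p\<in>?P. \<forall>p'\<in>?P. p \<noteq> p' \<longrightarrow> ?S p \<inter> ?S p' = {}"
    proof (intro ballI impI)
      fix p p' assume p: "p \<in> ?P" "p' \<in> ?P" "p \<noteq> p'"
      obtain u v u' v' where eq: "p = (u, v)" "p' = (u', v')" by (cases p, cases p')
      have "u = u' \<and> v = v'" if "b \<in> ?S p" "b \<in> ?S p'" for b
      proof -
        have "u = u'" "map ((+) l) v = map ((+) l) v'"
          using sep[of u v b] sep[of u' v' b] p that eq by auto
        then show ?thesis by (simp add: inj_map_eq_map)
      qed
      then show "?S p \<inter> ?S p' = {}" using p eq by blast
    qed
  qed (auto simp: finite_parking_functions)
  moreover have "(\<Sum>p\<in>?P. card (?S p)) = (\<Sum>p\<in>?P. q + r choose q)"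
    using card_S by (intro sum.cong) auto
  ultimately show ?thesis
    by (simp add: card_cartesian_product)
qed

theorem theorem4p3:
  fixes n k l :: nat
  assumes "n \<ge> 1" and "k + 1 \<le> l" and "l \<le> n + k - 1"
  shows "int (pf_count_first l n (n + k) (n + k)) - int (pf_count_first (l + 1) n (n + k) (n + k))
       = int ((n - 1) choose (l - k - 1)) * int (pf_count_le (l - k - 1) (l - 1) (l - 1))
           * int (pf_count (n + k - l))"
proof -
  \<comment> \<open>\<open>q\<close> and \<open>r\<close> count the tail entries below and above
    \<open>l\<close> in the critical case; the bounds on \<open>l\<close> keep both subtractions
    from truncating.\<close>
  define q r where "q = l - k - 1" and "r = n + k - l"
  have eqs: "n = Suc (q + r)" "n + k = l + r" "1 \<le> l"
    using assms by (auto simp: q_def r_def)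
  let ?T = "\<lambda>i. {b. i # b \<in> parking_functions n (n + k)}"
  have sub: "?T (Suc l) \<subseteq> ?T l"
    using parking_functions_head_mono eqs(3) by blast
  have fin: "finite (?T l)"
    using finite_vimageI[OF finite_parking_functions, of "(#) l" n "n + k"] by (simp add: vimage_def)
  have "int (card (?T l)) - int (card (?T (Suc l))) = int (card (?T l - ?T (Suc l)))"
    using sub fin by (simp add: card_Diff_subset finite_subset of_nat_diff card_mono)
  also have "card (?T l - ?T (Suc l))
      = (q + r choose q) * card (parking_functions q (l - 1)) * card (parking_functions r r)"
    unfolding eqs(2) using card_critical_tails[OF eqs(3), of q r] by (simp add: eqs(1))
  also have "q + r = n - 1" by (simp add: eqs(1))
  finally show ?thesis
    by (simp add: pf_count_first_self pf_count_le_self pf_count_def q_def r_def)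
qed

end
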